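(* The functor $T$ from Chermak partial groups to binary partial groups is left adjoint to the functor $B$ from binary partial groups to Chermak partial groups, with unit $\eta\colon \mathrm{id}\Rightarrow BT$ given by the Segal maps; that is, for each Chermak partial group $X$ and each $n$, the component $(\eta_X)_n\colon X_n\to (BTX)_n\subseteq X_1^{\times n}$ is the Segal map $\mathscr{E}_n$.
   Context: **Notation.** For expressions $a,b$ which may or may not be defined, $a \asymp b$ means that either both are undefined, or both are defined and $a=b$. **Binary partial groups.** A unital partial magma is a set $P$ with a partially defined binary operation $P\times P \nrightarrow P$, written $(a,b)\mapsto ab$, and an element $1\in P$ such that $a1\asymp a\asymp 1a$ for all $a\in P$. A binary partial group is a unital partial magma $P$ such that for each $a\in P$ there exists $a^\dagger\in P$ satisfying both of the following for all $b\in P$: (1) if $ab$ is defined then $a^\dagger(ab)\asymp b$; (2) if $ba$ is defined then $(ba)a^\dagger\asymp b$. The element $a^\dagger$ is unique. A map of binary partial groups $f\colon P\to Q$ is a (total) function such that whenever $ab$ is defined in $P$, the product $f(a)f(b)$ is defined in $Q$ and $f(ab)=f(a)f(b)$. (Such a map automatically preserves units and inverses.) **Chermak partial groups.** Let $\Upsilon$ be the category with objects $[n]=\{0,1,\dots,n\}$, $n\ge 0$, and morphisms all functions. A symmetric set is a functor $X\colon \Upsilon^{\mathrm{op}}\to \mathsf{Set}$; restricting along $\Delta^{\mathrm{op}}\to\Upsilon^{\mathrm{op}}$ gives its underlying simplicial set. The Segal map $\mathscr{E}_n\colon X_n\to X_1^{\times n}$ of a simplicial set has $i$-th component ($1\le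 i\le n$) induced by $[1]\to[n]$, $0\mapsto i-1$, $1\mapsto i$. A simplicial set is edgy if $\mathscr{E}_n$ is injective for all $n\ge 2$; a symmetric set is spiny if its underlying simplicial set is edgy; a simplicial or symmetric set $X$ is reduced if $X_0$ is a one-point set. A (Chermak) partial group is a reduced spiny symmetric set; partial groups form a full subcategory of symmetric sets. It is known that the forgetful functor from spiny symmetric sets to simplicial sets is fully faithful, and that an edgy simplicial set $X$ is in its essential image if and only if there is a simplicial map $\dagger\colon X^{\mathrm{op}}\to X$ such that (i) $\dagger\dagger^{\mathrm{op}}=\mathrm{id}_X$, and (ii) if $x\in X_n$ has $\mathscr{E}_n(x)=(a_1,\dots,a_n)$, then there is $y\in X_{2n}$ with $\mathscr{E}_{2n}(y)=(a_n^\dagger,\dots,a_1^\dagger,a_1,\dots,a_n)$ whose total product (the edge of $y$ from vertex $0$ to vertex $2n$) is a degenerate 1-simplex. Thus partial groups are identified with the reduced edgy simplicial sets admitting such a $\dagger$, with morphisms all simplicial maps. **The functor $B$.** For a binary partial group $P$, let $BP_n\subseteq P^{\times n}$ be the set of words $w$ of length $n$ such that every full parenthesization of $w$ gives a valid iterated multiplication in $P$ and all of these multiplications have the same value. So $BP_0=\ast$ (the empty word), $BP_1=P$, and $BP_2$ is the set of multipliable pairs. These sets form a simplicial set $BP$: inner face maps multiply two adjacent entries, outer face maps discard the first or last entry, and degeneracy maps insert the unit $1$. It is a Chermak partial group. A map $f\colon P\to Q$ of binary partial groups induces $Bf\colon BP\to BQ$ by applying $f$ entrywise. **The functor $T$.**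 For a Chermak partial group $X$, $TX$ is the set $X_1$ with the partial multiplication given by the span $X_1\times X_1 \xleftarrow{\mathscr{E}_2} X_2\xrightarrow{d_1}X_1$: $xy$ is defined if and only if $(x,y)=\mathscr{E}_2(z)$ for some (necessarily unique) $z\in X_2$, in which case $xy:=d_1(z)$; the unit is the degenerate 1-simplex. This is a binary partial group, and $T$ sends a map $X\to Y$ to its component $X_1\to Y_1$. *)

theory Defs
  imports "HOL-Library.FuncSet"
begin

section \<open>Binary partial groups\<close>

text \<open>
  A partial operation takes values in an option type, with \<open>None\<close> for ``undefined''.  Only the
  values of \<open>pmult\<close> on arguments from \<open>elems\<close> are relevant.
\<close>

record 'a pmagma =
  elems :: "'a set"
  pmult :: "'a \<Rightarrow> 'a \<Rightarrow> 'a option"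
  pone :: 'a

definition unital_partial_magma :: "'a pmagma \<Rightarrow> bool" where
  "unital_partial_magma P \<longleftrightarrow>
     (\<forall>a\<in>elems P. \<forall>b\<in>elems P. \<forall>c. pmult P a b = Some c \<longrightarrow> c \<in> elems P) \<and>
     pone P \<in> elems P \<and>
     (\<forall>a\<in>elems P. pmult P a (pone P) = Some a \<and> pmult P (pone P) a = Some a)"

definition is_pinv :: "'a pmagma \<Rightarrow> 'a \<Rightarrow> 'a \<Rightarrow> bool" where
  "is_pinv P a a' \<longleftrightarrow> a' \<in> elems P \<and>
     (\<forall>b\<in>elems P.
        (\<forall>c. pmult P a b = Some c \<longrightarrow> pmult P a' c = Some b) \<and>
        (\<forall>c. pmult P b a = Some c \<longrightarrow> pmult P c a' = Some b))"

definition binary_partial_group :: "'a pmagma \<Rightarrow> bool" where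
  "binary_partial_group P \<longleftrightarrow>
     unital_partial_magma P \<and> (\<forall>a\<in>elems P. \<exists>a'. is_pinv P a a')"

definition pinv :: "'a pmagma \<Rightarrow> 'a \<Rightarrow> 'a" where
  "pinv P a = (THE a'. is_pinv P a a')"

lemma is_pinv_unique:
  assumes "unital_partial_magma P" "a \<in> elems P" "is_pinv P a a'" "is_pinv P a a''"
  shows "a' = a''"
proof -
  have one: "pone P \<in> elems P" "pmult P a (pone P) = Some a"
    using assms(1,2) by (auto simp: unital_partial_magma_def)
  have "pmult P a' a = Some (pone P)"
    using assms(3) one unfolding is_pinv_def by blast
  then have "pmult P (pone P) a'' = Some a'"
    using assms(3,4) unfolding is_pinv_def by blast
  moreover have "pmult P (pone P) a'' = Some a''"
    using assms(1,4) by (auto simp: unital_partial_magma_def is_pinv_def)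
  ultimately show ?thesis by simp
qed

text \<open>
  Morphisms are extensional functions (they are \<open>undefined\<close> off the carrier), so that equality of
  morphisms is equality in HOL.
\<close>

definition bpg_hom :: "'a pmagma \<Rightarrow> 'b pmagma \<Rightarrow> ('a \<Rightarrow> 'b) set" where
  "bpg_hom P Q = {f. f \<in> elems P \<rightarrow>\<^sub>E elems Q \<and>
     (\<forall>a\<in>elems P. \<forall>b\<in>elems P. \<forall>c. pmult P a b = Some c \<longrightarrow> pmult Q (f a) (f b) = Some (f c))}"

definition bpg_id :: "'a pmagma \<Rightarrow> 'a \<Rightarrow> 'a" where
  "bpg_id P = (\<lambda>a\<in>elems P. a)"

definition bpg_comp :: "'a pmagma \<Rightarrow> ('b \<Rightarrow> 'c) \<Rightarrow> ('a \<Rightarrow> 'b) \<Rightarrow> 'a \<Rightarrow> 'c" where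
  "bpg_comp P g f = compose (elems P) g f"


section \<open>Symmetric sets and partial groups\<close>

text \<open>The set of all functions \<open>[m] \<rightarrow> [n]\<close>, where \<open>[n] = {0, \<dots>, n}\<close>.\<close>

definition Ups :: "nat \<Rightarrow> nat \<Rightarrow> (nat \<Rightarrow> nat) set" where
  "Ups m n = {..m} \<rightarrow>\<^sub>E {..n}"

text \<open>
  For \<open>\<alpha> \<in> Ups m n\<close>, the function \<open>act X m n \<alpha>\<close> is the structure map \<open>X\<^sub>n \<rightarrow> X\<^sub>m\<close> induced by \<open>\<alpha>\<close>.
  All levels have their elements in one type; this loses no generality, since that type may be a
  disjoint union.
\<close>

record 'a symset =
  cells :: "nat \<Rightarrow> 'a set"
  act :: "nat \<Rightarrow> nat \<Rightarrow> (nat \<Rightarrow> nat) \<Rightarrow> 'a \<Rightarrow> 'a"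

definition symmetric_set :: "'a symset \<Rightarrow> bool" where
  "symmetric_set X \<longleftrightarrow>
     (\<forall>m n. \<forall>\<alpha>\<in>Ups m n. \<forall>x\<in>cells X n. act X m n \<alpha> x \<in> cells X m) \<and>
     (\<forall>n. \<forall>x\<in>cells X n. act X n n (\<lambda>i\<in>{..n}. i) x = x) \<and>
     (\<forall>l m n. \<forall>\<alpha>\<in>Ups l m. \<forall>\<beta>\<in>Ups m n. \<forall>x\<in>cells X n.
        act X l n (compose {..l} \<beta> \<alpha>) x = act X l m \<alpha> (act X m n \<beta> x))"

text \<open>The map \<open>[1] \<rightarrow> [n]\<close> with \<open>0 \<mapsto> i\<close> and \<open>1 \<mapsto> j\<close>.\<close>

definition edge :: "nat \<Rightarrow> nat \<Rightarrow> nat \<Rightarrow> nat" where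
  "edge i j = (\<lambda>k\<in>{..1}. if k = 0 then i else j)"

text \<open>
  Tuples are lists.  The Segal map uses only order-preserving maps, so it, and hence edginess,
  depends only on the underlying simplicial set.
\<close>

definition segal :: "'a symset \<Rightarrow> nat \<Rightarrow> 'a \<Rightarrow> 'a list" where
  "segal X n x = map (\<lambda>i. act X 1 n (edge i (Suc i)) x) [0..<n]"

definition edgy :: "'a symset \<Rightarrow> bool" where
  "edgy X \<longleftrightarrow> (\<forall>n\<ge>2. inj_on (segal X n) (cells X n))"

definition reduced :: "'a symset \<Rightarrow> bool" where
  "reduced X \<longleftrightarrow> (\<exists>x. cells X 0 = {x})"

definition partial_group :: "'a symset \<Rightarrow> bool" where
  "partial_group X \<longleftrightarrow> symmetric_set X \<and> edgy X \<and> reduced X"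

definition sset_hom :: "'a symset \<Rightarrow> 'b symset \<Rightarrow> (nat \<Rightarrow> 'a \<Rightarrow> 'b) set" where
  "sset_hom X Y = {f. (\<forall>n. f n \<in> cells X n \<rightarrow>\<^sub>E cells Y n) \<and>
     (\<forall>m n. \<forall>\<alpha>\<in>Ups m n. \<forall>x\<in>cells X n. f m (act X m n \<alpha> x) = act Y m n \<alpha> (f n x))}"

definition sset_id :: "'a symset \<Rightarrow> nat \<Rightarrow> 'a \<Rightarrow> 'a" where
  "sset_id X = (\<lambda>n. \<lambda>x\<in>cells X n. x)"

definition sset_comp ::
  "'a symset \<Rightarrow> (nat \<Rightarrow> 'b \<Rightarrow> 'c) \<Rightarrow> (nat \<Rightarrow> 'a \<Rightarrow> 'b) \<Rightarrow> nat \<Rightarrow> 'a \<Rightarrow> 'c" where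
  "sset_comp X g f = (\<lambda>n. compose (cells X n) (g n) (f n))"


section \<open>The functor T\<close>

definition T_obj :: "'a symset \<Rightarrow> 'a pmagma" where
  "T_obj X = \<lparr>
     elems = cells X 1,
     pmult = (\<lambda>x y. if \<exists>z\<in>cells X 2. segal X 2 z = [x, y]
                    then Some (act X 1 2 (edge 0 2) (THE z. z \<in> cells X 2 \<and> segal X 2 z = [x, y]))
                    else None),
     pone = act X 1 0 (edge 0 0) (THE x. x \<in> cells X 0) \<rparr>"

definition T_map :: "(nat \<Rightarrow> 'a \<Rightarrow> 'b) \<Rightarrow> 'a \<Rightarrow> 'b" where
  "T_map f = f 1"


section \<open>The functor B\<close>

text \<open>A full parenthesization of a nonempty word is a binary tree with that word as its leaves.\<close>

datatype 'a paren = Letter 'a | Prod "'a paren" "'a paren"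

fun letters :: "'a paren \<Rightarrow> 'a list" where
  "letters (Letter a) = [a]"
| "letters (Prod s t) = letters s @ letters t"

fun peval :: "'a pmagma \<Rightarrow> 'a paren \<Rightarrow> 'a option" where
  "peval P (Letter a) = Some a"
| "peval P (Prod s t) =
     Option.bind (peval P s) (\<lambda>a. Option.bind (peval P t) (\<lambda>b. pmult P a b))"

definition has_value :: "'a pmagma \<Rightarrow> 'a list \<Rightarrow> 'a \<Rightarrow> bool" where
  "has_value P w v \<longleftrightarrow> (\<forall>t. letters t = w \<longrightarrow> peval P t = Some v)"

definition B_cells :: "'a pmagma \<Rightarrow> nat \<Rightarrow> 'a list set" where
  "B_cells P n = {w. length w = n \<and> set w \<subseteq> elems P \<and> (w = [] \<or> (\<exists>v. has_value P w v))}"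

definition word_val :: "'a pmagma \<Rightarrow> 'a list \<Rightarrow> 'a" where
  "word_val P w = (if w = [] then pone P else (THE v. has_value P w v))"

text \<open>
  The edge from vertex \<open>i\<close> to vertex \<open>j\<close> of a simplex \<open>w\<close> of \<open>BP\<close>: the product of the letters between
  the two vertices if \<open>i \<le> j\<close>, and the inverse of the edge from \<open>j\<close> to \<open>i\<close> otherwise.
\<close>

definition B_edge :: "'a pmagma \<Rightarrow> 'a list \<Rightarrow> nat \<Rightarrow> nat \<Rightarrow> 'a" where
  "B_edge P w i j =
     (if i \<le> j then word_val P (take (j - i) (drop i w))
      else pinv P (word_val P (take (i - j) (drop j w))))"

text \<open>
  For order-preserving \<open>\<alpha>\<close> this is the simplicial structure of \<open>BP\<close>; the lemmas below recover the
  usual faces and degeneracies.  The value at other \<open>\<alpha>\<close> is the extension to a symmetric set; as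
  the forgetful functor from spiny symmetric sets to simplicial sets is fully faithful, there is
  no other one.
\<close>

definition B_obj :: "'a pmagma \<Rightarrow> 'a list symset" where
  "B_obj P = \<lparr>
     cells = B_cells P,
     act = (\<lambda>m n \<alpha> w. map (\<lambda>k. B_edge P w (\<alpha> k) (\<alpha> (Suc k))) [0..<m]) \<rparr>"

definition B_map :: "'a pmagma \<Rightarrow> ('a \<Rightarrow> 'b) \<Rightarrow> nat \<Rightarrow> 'a list \<Rightarrow> 'b list" where
  "B_map P f = (\<lambda>n. \<lambda>w\<in>B_cells P n. map f w)"

definition coface :: "nat \<Rightarrow> nat \<Rightarrow> nat \<Rightarrow> nat" where
  "coface n i = (\<lambda>k\<in>{..n}. if k < i then k else Suc k)"

definition codegeneracy :: "nat \<Rightarrow> nat \<Rightarrow> nat \<Rightarrow> nat" where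
  "codegeneracy n i = (\<lambda>k\<in>{..Suc n}. if k \<le> i then k else k - 1)"

lemma letters_nonempty: "letters t \<noteq> []"
  by (induction t) auto

lemma letters_single: "letters t = [a] \<longleftrightarrow> t = Letter a"
  by (cases t) (auto simp: append_eq_Cons_conv letters_nonempty)

lemma letters_pair: "letters t = [a, b] \<longleftrightarrow> t = Prod (Letter a) (Letter b)"
  by (cases t) (auto simp: append_eq_Cons_conv letters_nonempty letters_single)

lemma word_val_Nil: "word_val P [] = pone P"
  by (simp add: word_val_def)

lemma word_val_single: "word_val P [a] = a"
  by (auto simp: word_val_def has_value_def letters_single intro!: the_equality)

lemma has_value_pair: "has_value P [a, b] v \<longleftrightarrow> pmult P a b = Some v"
  by (simp add: has_value_def letters_pair)

lemma word_val_pair: "pmult P a b = Some v \<Longrightarrow> word_val P [a, b] = v"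
  by (auto simp: word_val_def has_value_pair intro!: the_equality)

lemma B_edge_refl: "B_edge P w i i = pone P"
  by (simp add: B_edge_def word_val_Nil)

lemma B_edge_Suc: "i < length w \<Longrightarrow> B_edge P w i (Suc i) = w ! i"
  by (simp add: B_edge_def take_Suc_conv_app_nth word_val_single)

lemma subtree_peval:
  assumes "has_value P (u @ v @ w) c"
  shows "\<forall>t. letters t = v \<longrightarrow> peval P t \<noteq> None"
proof -
  have ext: "\<exists>s. letters s = u @ letters t \<and> (peval P s \<noteq> None \<longrightarrow> peval P t \<noteq> None)"
    for u and t :: "'a paren"
  proof (induction u)
    case Nil
    then show ?case by auto
  next
    case (Cons a u)
    then obtain s where "letters s = u @ letters t" "peval P s \<noteq> None \<longrightarrow> peval P t \<noteq> None"
      by blast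
    then show ?case
      by (intro exI[of _ "Prod (Letter a) s"]) (auto simp: bind_eq_Some_conv)
  qed
  have ext': "\<exists>s. letters s = letters t @ w \<and> (peval P s \<noteq> None \<longrightarrow> peval P t \<noteq> None)"
    for w and t :: "'a paren"
  proof (induction w rule: rev_induct)
    case Nil
    then show ?case by auto
  next
    case (snoc a w)
    then obtain s where "letters s = letters t @ w" "peval P s \<noteq> None \<longrightarrow> peval P t \<noteq> None"
      by blast
    then show ?case
      by (intro exI[of _ "Prod s (Letter a)"]) (auto simp: bind_eq_Some_conv)
  qed
  have "peval P t \<noteq> None" if "letters t = v" for t
  proof -
    obtain s where s: "letters s = letters t @ w" "peval P s \<noteq> None \<longrightarrow> peval P t \<noteq> None"
      using ext' by blast
    obtain r where "letters r = u @ letters s" "peval P r \<noteq> None \<longrightarrow> peval P s \<noteq> None"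
      using ext by blast
    moreover from this s that have "peval P r = Some c"
      using assms by (simp add: has_value_def)
    ultimately show ?thesis using s by simp
  qed
  then show ?thesis by blast
qed

lemma B_edge_Suc_Suc:
  assumes "w \<in> B_cells P n" and "Suc i < n"
  shows "pmult P (w ! i) (w ! Suc i) = Some (B_edge P w i (Suc (Suc i)))"
proof -
  have len: "length w = n" and ne: "w \<noteq> []" using assms by (auto simp: B_cells_def)
  then obtain c where c: "has_value P w c" using assms by (auto simp: B_cells_def)
  have tk: "take 2 (drop i w) = [w ! i, w ! Suc i]"
    using assms len by (simp add: numeral_2_eq_2 Cons_nth_drop_Suc[symmetric])
  have w: "w = take i w @ [w ! i, w ! Suc i] @ drop (Suc (Suc i)) w"
    using assms len by (simp add: Cons_nth_drop_Suc)
  from subtree_peval[of P "take i w" "[w ! i, w ! Suc i]" "drop (Suc (Suc i)) w" c] c w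
  have "pmult P (w ! i) (w ! Suc i) \<noteq> None"
    by (simp add: letters_pair)
  then obtain v where v: "pmult P (w ! i) (w ! Suc i) = Some v" by auto
  then show ?thesis using tk by (simp add: B_edge_def word_val_pair numeral_2_eq_2)
qed

lemma B_first_face:
  assumes "w \<in> B_cells P (Suc n)"
  shows "act (B_obj P) n (Suc n) (coface n 0) w = tl w"
  using assms
  by (auto simp: B_obj_def coface_def B_cells_def nth_tl B_edge_Suc intro!: nth_equalityI)

lemma B_last_face:
  assumes "w \<in> B_cells P (Suc n)"
  shows "act (B_obj P) n (Suc n) (coface n (Suc n)) w = butlast w"
  using assms
  by (auto simp: B_obj_def coface_def B_cells_def nth_butlast B_edge_Suc intro!: nth_equalityI)

lemma B_inner_face:
  assumes "w \<in> B_cells P (Suc n)" and "Suc i \<le> n"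
  shows "act (B_obj P) n (Suc n) (coface n (Suc i)) w
           = take i w @ the (pmult P (w ! i) (w ! Suc i)) # drop (Suc (Suc i)) w"
proof (rule nth_equalityI)
  have len: "length w = Suc n" using assms by (simp add: B_cells_def)
  show "length (act (B_obj P) n (Suc n) (coface n (Suc i)) w)
          = length (take i w @ the (pmult P (w ! i) (w ! Suc i)) # drop (Suc (Suc i)) w)"
    using len assms by (simp add: B_obj_def)
  fix k assume "k < length (act (B_obj P) n (Suc n) (coface n (Suc i)) w)"
  then have k: "k < n" by (simp add: B_obj_def)
  consider "k < i" | "k = i" | "i < k" by linarith
  then show "act (B_obj P) n (Suc n) (coface n (Suc i)) w ! k
          = (take i w @ the (pmult P (w ! i) (w ! Suc i)) # drop (Suc (Suc i)) w) ! k"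
  proof cases
    case 1
    then show ?thesis using k len by (simp add: B_obj_def coface_def nth_append B_edge_Suc)
  next
    case 2
    then show ?thesis using k len assms B_edge_Suc_Suc[OF assms(1), of i]
      by (simp add: B_obj_def coface_def nth_append)
  next
    case 3
    then obtain d where "k = Suc (i + d)" using less_imp_Suc_add by blast
    then show ?thesis using k len by (simp add: B_obj_def coface_def nth_append B_edge_Suc)
  qed
qed

lemma B_degeneracy:
  assumes "w \<in> B_cells P n" and "i \<le> n"
  shows "act (B_obj P) (Suc n) n (codegeneracy n i) w = take i w @ pone P # drop i w"
proof (rule nth_equalityI)
  have len: "length w = n" using assms by (simp add: B_cells_def)
  show "length (act (B_obj P) (Suc n) n (codegeneracy n i) w)
          = length (take i w @ pone P # drop i w)"
    using len assms by (simp add: B_obj_def)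
  fix k assume "k < length (act (B_obj P) (Suc n) n (codegeneracy n i) w)"
  then have k: "k < Suc n" by (simp add: B_obj_def)
  consider "k < i" | "k = i" | "i < k" by linarith
  then show "act (B_obj P) (Suc n) n (codegeneracy n i) w ! k
          = (take i w @ pone P # drop i w) ! k"
  proof cases
    case 1
    then show ?thesis using k len assms
      by (simp add: B_obj_def codegeneracy_def nth_append B_edge_Suc del: upt_Suc)
  next
    case 2
    then show ?thesis using k len assms
      by (simp add: B_obj_def codegeneracy_def nth_append B_edge_refl del: upt_Suc)
  next
    case 3
    then obtain d where "k = Suc (i + d)" using less_imp_Suc_add by blast
    then show ?thesis using k len
      by (simp add: B_obj_def codegeneracy_def nth_append B_edge_Suc del: upt_Suc)
  qed
qed


section \<open>The unit\<close>

definition eta :: "'a symset \<Rightarrow> nat \<Rightarrow> 'a \<Rightarrow> 'a list" where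
  "eta X = (\<lambda>n. \<lambda>x\<in>cells X n. segal X n x)"

end

theory Submission
  imports Defs
begin

text \<open>
  Everything rests on one notion.  Call a family of elements \<open>e i j\<close> of a binary partial group,
  indexed by \<^emph>\<open>all\<close> pairs of vertices in \<open>{0, \<dots>, n}\<close>, a cocycle if
  \<open>e i j \<cdot> e j k\<close> is always defined and equal to \<open>e i k\<close>.  The cells of \<open>BP\<close> of dimension \<open>n\<close> are the
  same thing as cocycles on \<open>{0, \<dots>, n}\<close>: a cocycle gives the word of its edges \<open>e k (k + 1)\<close>, every
  parenthesization of which evaluates to the long edge \<open>e 0 n\<close> (\<open>cocycle_cell\<close>), and conversely the
  edges of a cell form a cocycle (\<open>cell_cocycle\<close>).  The converse uses cancellation: it shows
  that a subword of a cell is again a cell, hence that \<open>e i j \<cdot> e j k = e i k\<close> for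
  \<open>i \<le> j \<le> k\<close>; the other five orderings follow from this one by the axioms on inverses.

  A cocycle can be pulled back along any function between vertex sets, and it is determined by its
  edges \<open>e k (k + 1)\<close> (\<open>cocycle_B_edge\<close>).  Hence \<open>BP\<close> is a symmetric set; it is spiny because a
  word is the list of its letters, and reduced because only the empty word has length zero.  Maps
  of binary partial groups carry cocycles to cocycles, so \<open>B\<close> is functorial.

  On the other side, the edges of a simplex of a partial group \<open>X\<close> form a cocycle in \<open>TX\<close>
  (\<open>T_cocycle\<close>), as is seen by restricting the simplex to three of its vertices;
  this yields that \<open>TX\<close> is a binary partial group and that the Segal
  maps take values in \<open>BTX\<close> and are natural.  Finally, a cell of \<open>BP\<close> is the list of its edges
  \<open>k \<rightarrow> k + 1\<close>, so a symmetric map \<open>X \<rightarrow> BP\<close> is determined by its values on \<open>1\<close>-simplices, and these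
  values are multiplicative because the edges of a \<open>2\<close>-cell form a cocycle.
\<close>

section \<open>Cancellation in binary partial groups\<close>

lemma pmult_closed:
  assumes "binary_partial_group P" "a \<in> elems P" "b \<in> elems P" "pmult P a b = Some c"
  shows "c \<in> elems P"
  using assms unfolding binary_partial_group_def unital_partial_magma_def by blast

lemma pone_closed: "binary_partial_group P \<Longrightarrow> pone P \<in> elems P"
  unfolding binary_partial_group_def unital_partial_magma_def by blast

lemma pmult_pone:
  assumes "binary_partial_group P" "a \<in> elems P"
  shows "pmult P a (pone P) = Some a" "pmult P (pone P) a = Some a"
  using assms unfolding binary_partial_group_def unital_partial_magma_def by blast+

lemma pinv_is_pinv:
  assumes "binary_partial_group P" "a \<in> elems P"
  shows "is_pinv P a (pinv P a)"
proof -
  obtain a' where a': "is_pinv P a a'"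
    using assms unfolding binary_partial_group_def by blast
  have "pinv P a = a'"
    unfolding pinv_def
    using a' assms is_pinv_unique[of P a] by (auto simp: binary_partial_group_def)
  with a' show ?thesis by simp
qed

lemma pinv_closed:
  assumes "binary_partial_group P" "a \<in> elems P"
  shows "pinv P a \<in> elems P"
  using pinv_is_pinv[OF assms] by (simp add: is_pinv_def)

lemma pmult_pinv_left:
  assumes "binary_partial_group P" "a \<in> elems P" "b \<in> elems P" "pmult P a b = Some c"
  shows "pmult P (pinv P a) c = Some b"
  using pinv_is_pinv[OF assms(1,2)] assms by (simp add: is_pinv_def)

lemma pmult_pinv_right:
  assumes "binary_partial_group P" "a \<in> elems P" "b \<in> elems P" "pmult P a b = Some c"
  shows "pmult P c (pinv P b) = Some a"
  using pinv_is_pinv[OF assms(1,3)] assms by (simp add: is_pinv_def)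

lemma pinv_eqI:
  assumes P: "binary_partial_group P" and a: "a \<in> elems P" and b: "b \<in> elems P"
    and ab: "pmult P a b = Some (pone P)"
  shows "pinv P a = b"
proof -
  have "pmult P (pinv P a) (pone P) = Some b"
    using pmult_pinv_left[OF P a b ab] .
  moreover have "pmult P (pinv P a) (pone P) = Some (pinv P a)"
    using pmult_pone[OF P] pinv_closed[OF P a] by blast
  ultimately show ?thesis by simp
qed

lemma idempotent_eq_pone:
  assumes P: "binary_partial_group P" and a: "a \<in> elems P" and aa: "pmult P a a = Some a"
  shows "a = pone P"
  using pmult_pinv_left[OF P a a aa] pmult_pinv_left[OF P a pone_closed[OF P] pmult_pone(1)[OF P a]]
  by simp

section \<open>Cocycles\<close>

text \<open>
  The elements \<open>e i j\<close>, for vertices \<open>i\<close> and \<open>j\<close> in either order, are thought of as the edges of a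
  simplex with vertices \<open>0, \<dots>, n\<close>; the values of \<open>e\<close> at larger indices are irrelevant.
\<close>

definition cocycle :: "'a pmagma \<Rightarrow> nat \<Rightarrow> (nat \<Rightarrow> nat \<Rightarrow> 'a) \<Rightarrow> bool" where
  "cocycle P n e \<longleftrightarrow> (\<forall>i\<le>n. \<forall>j\<le>n. e i j \<in> elems P) \<and>
     (\<forall>i\<le>n. \<forall>j\<le>n. \<forall>k\<le>n. pmult P (e i j) (e j k) = Some (e i k))"

lemma cocycle_closed: "cocycle P n e \<Longrightarrow> i \<le> n \<Longrightarrow> j \<le> n \<Longrightarrow> e i j \<in> elems P"
  by (simp add: cocycle_def)

lemma cocycle_mult:
  "cocycle P n e \<Longrightarrow> i \<le> n \<Longrightarrow> j \<le> n \<Longrightarrow> k \<le> n \<Longrightarrow> pmult P (e i j) (e j k) = Some (e i k)"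
  by (simp add: cocycle_def)

lemma cocycle_refl:
  assumes "binary_partial_group P" "cocycle P n e" "i \<le> n"
  shows "e i i = pone P"
  using idempotent_eq_pone[OF assms(1) cocycle_closed[OF assms(2,3,3)] cocycle_mult[OF assms(2,3,3,3)]] .

lemma cocycle_pinv:
  assumes "binary_partial_group P" "cocycle P n e" "i \<le> n" "j \<le> n"
  shows "pinv P (e i j) = e j i"
proof (rule pinv_eqI[OF assms(1)])
  show "e i j \<in> elems P" "e j i \<in> elems P" using cocycle_closed[OF assms(2)] assms(3,4) by simp_all
  show "pmult P (e i j) (e j i) = Some (pone P)"
    using cocycle_refl[OF assms(1-3)] cocycle_mult[OF assms(2-4,3)] by simp
qed

lemma cocycle_pullback:
  assumes "cocycle P n e" "\<And>i. i \<le> m \<Longrightarrow> \<alpha> i \<le> n"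
  shows "cocycle P m (\<lambda>i j. e (\<alpha> i) (\<alpha> j))"
  using assms by (simp add: cocycle_def)

lemma cocycle_image:
  assumes "cocycle P n e" "f \<in> bpg_hom P Q"
  shows "cocycle Q n (\<lambda>i j. f (e i j))"
proof -
  have "f a \<in> elems Q" if "a \<in> elems P" for a
    using assms(2) that by (auto simp: bpg_hom_def)
  moreover have "pmult Q (f a) (f b) = Some (f c)"
    if "a \<in> elems P" "b \<in> elems P" "pmult P a b = Some c" for a b c
    using assms(2) that by (simp add: bpg_hom_def)
  ultimately show ?thesis
    using assms(1) by (simp add: cocycle_def)
qed

section \<open>Words with a value\<close>

lemma ex_letters: "w \<noteq> [] \<Longrightarrow> \<exists>t. letters t = w"
proof (induction w)
  case (Cons a w)
  show ?case
  proof (cases "w = []")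
    case True
    then show ?thesis by (intro exI[of _ "Letter a"]) simp
  next
    case False
    with Cons obtain t where "letters t = w" by blast
    then show ?thesis by (intro exI[of _ "Prod (Letter a) t"]) simp
  qed
qed simp

lemma has_value_word_val:
  assumes "has_value P w v" "w \<noteq> []"
  shows "word_val P w = v"
proof -
  obtain t where "letters t = w" using ex_letters[OF assms(2)] by blast
  then have "v' = v" if "has_value P w v'" for v'
    using that assms(1) by (auto simp: has_value_def)
  with assms(1) have "(THE v. has_value P w v) = v" by (rule the_equality)
  with assms(2) show ?thesis by (simp add: word_val_def)
qed

lemma peval_closed:
  assumes "binary_partial_group P" "set (letters t) \<subseteq> elems P" "peval P t = Some v"
  shows "v \<in> elems P"
  using assms(2,3)
  by (induction t arbitrary: v) (auto simp: bind_eq_Some_conv dest: pmult_closed[OF assms(1), rotated 2])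

text \<open>
  A parenthesization of a final segment extends to one of the whole word, and the value of the
  segment is recovered from the value of the whole by cancellation; so it does not depend on
  the parenthesization.
\<close>

lemma has_value_Cons:
  assumes P: "binary_partial_group P" and w: "has_value P (a # v) c"
    and sub: "set (a # v) \<subseteq> elems P"
  shows "\<exists>b. has_value P v b"
proof -
  have "peval P t = pmult P (pinv P a) c" if t: "letters t = v" for t
  proof -
    have "letters (Prod (Letter a) t) = a # v" using t by simp
    then have "peval P (Prod (Letter a) t) = Some c"
      using w unfolding has_value_def by blast
    then obtain b where b: "peval P t = Some b" "pmult P a b = Some c"
      by (auto simp: bind_eq_Some_conv)
    have "b \<in> elems P" using peval_closed[OF P _ b(1)] t sub by simp
    with b show ?thesis using pmult_pinv_left[OF P _ _ b(2)] sub by simp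
  qed
  moreover have "peval P t \<noteq> None" if "letters t = v" for t
    using subtree_peval[of P "[a]" v "[]" c] w that by simp
  ultimately show ?thesis
    unfolding has_value_def by (cases "pmult P (pinv P a) c") auto
qed

lemma has_value_snoc:
  assumes P: "binary_partial_group P" and w: "has_value P (v @ [a]) c"
    and sub: "set (v @ [a]) \<subseteq> elems P"
  shows "\<exists>b. has_value P v b"
proof -
  have "peval P t = pmult P c (pinv P a)" if t: "letters t = v" for t
  proof -
    have "letters (Prod t (Letter a)) = v @ [a]" using t by simp
    then have "peval P (Prod t (Letter a)) = Some c"
      using w unfolding has_value_def by blast
    then obtain b where b: "peval P t = Some b" "pmult P b a = Some c"
      by (auto simp: bind_eq_Some_conv)
    have "b \<in> elems P" using peval_closed[OF P _ b(1)] t sub by simp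
    with b show ?thesis using pmult_pinv_right[OF P _ _ b(2)] sub by simp
  qed
  moreover have "peval P t \<noteq> None" if "letters t = v" for t
    using subtree_peval[of P "[]" v "[a]" c] w that by simp
  ultimately show ?thesis
    unfolding has_value_def by (cases "pmult P c (pinv P a)") auto
qed

lemma has_value_suffix:
  assumes P: "binary_partial_group P"
  shows "has_value P (u @ v) c \<Longrightarrow> set (u @ v) \<subseteq> elems P \<Longrightarrow> \<exists>b. has_value P v b"
proof (induction u arbitrary: c)
  case (Cons a u)
  then obtain b where "has_value P (u @ v) b"
    using has_value_Cons[OF P, of a "u @ v" c] by auto
  with Cons show ?case by simp
qed auto

lemma has_value_prefix:
  assumes P: "binary_partial_group P"
  shows "has_value P (u @ v) c \<Longrightarrow> set (u @ v) \<subseteq> elems P \<Longrightarrow> \<exists>b. has_value P u b"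
proof (induction v arbitrary: c rule: rev_induct)
  case (snoc a v)
  then obtain b where "has_value P (u @ v) b"
    using has_value_snoc[OF P, of "u @ v" a c] by auto
  with snoc show ?case by simp
qed auto

lemma word_val_closed:
  assumes P: "binary_partial_group P" and w: "w \<in> B_cells P n"
  shows "word_val P w \<in> elems P"
proof (cases "w = []")
  case True
  then show ?thesis using pone_closed[OF P] by (simp add: word_val_Nil)
next
  case False
  with w obtain v where v: "has_value P w v" by (auto simp: B_cells_def)
  obtain t where t: "letters t = w" using ex_letters[OF False] by blast
  have "v \<in> elems P" using peval_closed[OF P, of t v] v t w by (auto simp: has_value_def B_cells_def)
  then show ?thesis using has_value_word_val[OF v False] by simp
qed

lemma B_cells_appendD:
  assumes P: "binary_partial_group P" and w: "u @ v \<in> B_cells P n"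
  shows "u \<in> B_cells P (length u)" "v \<in> B_cells P (length v)"
proof -
  have sub: "set (u @ v) \<subseteq> elems P" using w by (simp add: B_cells_def)
  show "u \<in> B_cells P (length u)"
  proof (cases "u = []")
    case False
    then obtain c where "has_value P (u @ v) c" using w by (auto simp: B_cells_def)
    then show ?thesis using has_value_prefix[OF P _ sub] sub by (simp add: B_cells_def)
  qed (simp add: B_cells_def)
  show "v \<in> B_cells P (length v)"
  proof (cases "v = []")
    case False
    then obtain c where "has_value P (u @ v) c" using w by (auto simp: B_cells_def)
    then show ?thesis using has_value_suffix[OF P _ sub] sub by (simp add: B_cells_def)
  qed (simp add: B_cells_def)
qed

lemma word_val_append:
  assumes P: "binary_partial_group P" and w: "u @ v \<in> B_cells P n"
  shows "pmult P (word_val P u) (word_val P v) = Some (word_val P (u @ v))"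
proof -
  note uv = B_cells_appendD[OF P w]
  consider "u = []" | "v = []" | "u \<noteq> []" "v \<noteq> []" by blast
  then show ?thesis
  proof cases
    case 1
    then show ?thesis using pmult_pone[OF P word_val_closed[OF P uv(2)]] by (simp add: word_val_Nil)
  next
    case 2
    then show ?thesis using pmult_pone[OF P word_val_closed[OF P uv(1)]] by (simp add: word_val_Nil)
  next
    case 3
    obtain a b c where val: "has_value P u a" "has_value P v b" "has_value P (u @ v) c"
      using uv w 3 by (auto simp: B_cells_def)
    obtain s t where st: "letters s = u" "letters t = v" using ex_letters 3 by metis
    have "letters (Prod s t) = u @ v" using st by simp
    then have "peval P (Prod s t) = Some c" using val(3) unfolding has_value_def by blast
    moreover have "peval P s = Some a" "peval P t = Some b"
      using val st unfolding has_value_def by simp_all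
    ultimately have "pmult P a b = Some c" by simp
    then show ?thesis using val 3 by (simp add: has_value_word_val)
  qed
qed

section \<open>Cells of BP are cocycles\<close>

lemma cell_segment:
  assumes P: "binary_partial_group P" and w: "w \<in> B_cells P n" and "i \<le> j" "j \<le> n"
  shows "take (j - i) (drop i w) \<in> B_cells P (j - i)"
proof -
  have len: "length w = n" using w by (simp add: B_cells_def)
  have "drop i w \<in> B_cells P (length (drop i w))"
    using B_cells_appendD(2)[OF P, of "take i w" "drop i w"] w by simp
  then have "take (j - i) (drop i w) @ drop (j - i) (drop i w) \<in> B_cells P (length (drop i w))"
    by (simp only: append_take_drop_id)
  then have "take (j - i) (drop i w) \<in> B_cells P (length (take (j - i) (drop i w)))"
    by (rule B_cells_appendD(1)[OF P])
  moreover have "length (take (j - i) (drop i w)) = j - i" using len assms by simp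
  ultimately show ?thesis by (simp only:)
qed

lemma cell_cocycle:
  assumes P: "binary_partial_group P" and w: "w \<in> B_cells P n"
  shows "cocycle P n (B_edge P w)"
proof -
  let ?e = "B_edge P w"
  have cl: "?e i j \<in> elems P" if "i \<le> n" "j \<le> n" for i j
    using that word_val_closed[OF P cell_segment[OF P w, of i j]]
      pinv_closed[OF P word_val_closed[OF P cell_segment[OF P w, of j i]]]
    by (simp add: B_edge_def)
  have forward: "pmult P (?e i j) (?e j k) = Some (?e i k)" if "i \<le> j" "j \<le> k" "k \<le> n" for i j k
  proof -
    have "k - i = (j - i) + (k - j)" and "drop (j - i) (drop i w) = drop j w" using that by simp_all
    then have "take (k - i) (drop i w) = take (j - i) (drop i w) @ take (k - j) (drop j w)"
      by (simp only: take_add)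
    moreover have "take (k - i) (drop i w) \<in> B_cells P (k - i)"
      using cell_segment[OF P w] that by simp
    ultimately show ?thesis
      using word_val_append[OF P, of "take (j - i) (drop i w)" "take (k - j) (drop j w)"] that
      by (simp add: B_edge_def)
  qed
  have inv: "pinv P (?e i j) = ?e j i" if "i \<le> n" "j \<le> n" for i j
  proof (cases i j rule: linorder_cases)
    case less
    then show ?thesis by (simp add: B_edge_def)
  next
    case equal
    then show ?thesis
      using pinv_eqI[OF P pone_closed[OF P] pone_closed[OF P]] pmult_pone[OF P pone_closed[OF P]]
      by (simp add: B_edge_refl)
  next
    case greater
    let ?a = "?e j i"
    have a: "?a \<in> elems P" using cl that by blast
    have "pmult P (pinv P ?a) ?a = Some (pone P)"
      using pmult_pinv_left[OF P a pone_closed[OF P]] pmult_pone[OF P a] by simp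
    then have "pinv P (pinv P ?a) = ?a"
      by (rule pinv_eqI[OF P pinv_closed[OF P a] a])
    moreover have "?e i j = pinv P ?a" using greater by (simp add: B_edge_def)
    ultimately show ?thesis by simp
  qed
  \<comment> \<open>The two inverse axioms permute the three vertices by two transpositions, which generate the
    symmetric group.\<close>
  have left: "pmult P (?e j i) (?e i k) = Some (?e j k)"
    if "pmult P (?e i j) (?e j k) = Some (?e i k)" "i \<le> n" "j \<le> n" "k \<le> n" for i j k
    using pmult_pinv_left[OF P cl cl that(1)] that by (simp add: inv)
  have right: "pmult P (?e i k) (?e k j) = Some (?e i j)"
    if "pmult P (?e i j) (?e j k) = Some (?e i k)" "i \<le> n" "j \<le> n" "k \<le> n" for i j k
    using pmult_pinv_right[OF P cl cl that(1)] that by (simp add: inv)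
  have "pmult P (?e i j) (?e j k) = Some (?e i k)" if "i \<le> n" "j \<le> n" "k \<le> n" for i j k
  proof -
    consider "i \<le> j" "j \<le> k" | "i \<le> k" "k \<le> j" | "j \<le> i" "i \<le> k"
      | "j \<le> k" "k \<le> i" | "k \<le> i" "i \<le> j" | "k \<le> j" "j \<le> i" by linarith
    then show ?thesis
    proof cases
      case 1
      then show ?thesis using forward that by blast
    next
      case 2
      then show ?thesis using right[OF forward] that by blast
    next
      case 3
      then show ?thesis using left[OF forward] that by blast
    next
      case 4
      then show ?thesis using left[OF right[OF forward]] that by blast
    next
      case 5
      then show ?thesis using right[OF left[OF forward]] that by blast
    next
      case 6
      then show ?thesis using left[OF right[OF left[OF forward]]] that by blast
    qed
  qed
  with cl show ?thesis by (simp add: cocycle_def)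
qed

text \<open>Multiplying along a path of edges of a cocycle telescopes, whatever the parenthesization.\<close>

lemma peval_path:
  assumes e: "cocycle P n e"
  shows "letters t = map (\<lambda>k. e k (Suc k)) [i..<j] \<Longrightarrow> j \<le> n \<Longrightarrow> i < j \<and> peval P t = Some (e i j)"
proof (induction t arbitrary: i j)
  case (Letter a)
  have "j - i = 1" using arg_cong[OF Letter.prems(1), of length] by simp
  then have "j = Suc i" by simp
  with Letter show ?case by simp
next
  case (Prod s t)
  let ?l = "i + length (letters s)"
  have "length (letters s) + length (letters t) = j - i"
    using arg_cong[OF Prod.prems(1), of length] by simp
  moreover have "length (letters t) > 0" using letters_nonempty[of t] by simp
  ultimately have l: "i \<le> ?l" "?l \<le> j" "j = ?l + length (letters t)" by linarith+
  have "map (\<lambda>k. e k (Suc k)) [i..<j]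
      = map (\<lambda>k. e k (Suc k)) [i..<?l] @ map (\<lambda>k. e k (Suc k)) [?l..<j]"
    using l by (metis map_append upt_add_eq_append)
  then have split: "letters s = map (\<lambda>k. e k (Suc k)) [i..<?l]"
      "letters t = map (\<lambda>k. e k (Suc k)) [?l..<j]"
    using Prod.prems(1) by simp_all
  have "i < ?l \<and> peval P s = Some (e i ?l)" "?l < j \<and> peval P t = Some (e ?l j)"
    using Prod.IH(1)[OF split(1)] Prod.IH(2)[OF split(2)] l Prod.prems(2) by simp_all
  then show ?case using cocycle_mult[OF e, of i ?l j] l Prod.prems(2) by simp
qed

lemma has_value_path:
  assumes "cocycle P n e" "j \<le> n"
  shows "has_value P (map (\<lambda>k. e k (Suc k)) [i..<j]) (e i j)"
  using assms peval_path unfolding has_value_def by blast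

lemma cocycle_cell:
  assumes e: "cocycle P n e"
  shows "map (\<lambda>k. e k (Suc k)) [0..<n] \<in> B_cells P n"
  using has_value_path[OF e order_refl, of 0] cocycle_closed[OF e]
  unfolding B_cells_def by auto

lemma cocycle_B_edge:
  assumes P: "binary_partial_group P" and e: "cocycle P n e" and ij: "i \<le> n" "j \<le> n"
  shows "B_edge P (map (\<lambda>k. e k (Suc k)) [0..<n]) i j = e i j"
proof -
  have val: "word_val P (take (j - i) (drop i (map (\<lambda>k. e k (Suc k)) [0..<n]))) = e i j"
    if "i \<le> j" "j \<le> n" for i j
  proof (cases "i = j")
    case True
    then show ?thesis using cocycle_refl[OF P e] that by (simp add: word_val_Nil)
  next
    case False
    have "take (j - i) (drop i (map (\<lambda>k. e k (Suc k)) [0..<n])) = map (\<lambda>k. e k (Suc k)) [i..<j]"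
      using that by (simp add: drop_map take_map)
    then show ?thesis using has_value_word_val[OF has_value_path[OF e, of j i]] that False by simp
  qed
  show ?thesis
    using val[of i j] val[of j i] cocycle_pinv[OF P e] ij by (auto simp: B_edge_def)
qed

section \<open>The partial group BP\<close>

lemma cells_B: "cells (B_obj P) n = B_cells P n"
  by (simp add: B_obj_def)

lemma act_B: "act (B_obj P) m n \<alpha> w = map (\<lambda>k. B_edge P w (\<alpha> k) (\<alpha> (Suc k))) [0..<m]"
  by (simp add: B_obj_def)

lemma Ups_le: "\<alpha> \<in> Ups m n \<Longrightarrow> i \<le> m \<Longrightarrow> \<alpha> i \<le> n"
  by (auto simp: Ups_def)

lemma edge_Ups: "i \<le> n \<Longrightarrow> j \<le> n \<Longrightarrow> edge i j \<in> Ups 1 n"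
  by (auto simp: Ups_def edge_def)

lemma B_act_edge: "act (B_obj P) 1 n (edge i j) w = [B_edge P w i j]"
  by (simp add: act_B edge_def)

lemma B_cell_path:
  assumes "w \<in> B_cells P n"
  shows "map (\<lambda>k. B_edge P w k (Suc k)) [0..<n] = w"
  using assms by (auto simp: B_cells_def B_edge_Suc intro!: nth_equalityI)

text \<open>
  An operator acts on cells of \<open>BP\<close> by pulling back the cocycle of edges along a map of vertices.
\<close>

lemma B_act_cell:
  assumes "binary_partial_group P" "\<alpha> \<in> Ups m n" "w \<in> B_cells P n"
  shows "act (B_obj P) m n \<alpha> w \<in> B_cells P m"
  unfolding act_B
  by (rule cocycle_cell, rule cocycle_pullback[OF cell_cocycle[OF assms(1,3)]])
    (rule Ups_le[OF assms(2)])

lemma B_edge_act: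
  assumes "binary_partial_group P" "\<alpha> \<in> Ups m n" "w \<in> B_cells P n" "i \<le> m" "j \<le> m"
  shows "B_edge P (act (B_obj P) m n \<alpha> w) i j = B_edge P w (\<alpha> i) (\<alpha> j)"
  unfolding act_B
  using cocycle_B_edge[OF assms(1) cocycle_pullback[OF cell_cocycle[OF assms(1,3)]], of m \<alpha> i j]
    Ups_le[OF assms(2)] assms(4,5) by simp

lemma segal_B:
  assumes "w \<in> B_cells P n"
  shows "segal (B_obj P) n w = map (\<lambda>a. [a]) w"
proof -
  have "segal (B_obj P) n w = map (\<lambda>a. [a]) (map (\<lambda>k. B_edge P w k (Suc k)) [0..<n])"
    unfolding segal_def B_act_edge by simp
  then show ?thesis using B_cell_path[OF assms] by simp
qed

lemma partial_group_B:
  assumes P: "binary_partial_group P"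
  shows "partial_group (B_obj P)"
proof -
  have "act (B_obj P) n n (\<lambda>i\<in>{..n}. i) w = w" if "w \<in> B_cells P n" for n w
  proof -
    have "act (B_obj P) n n (\<lambda>i\<in>{..n}. i) w = map (\<lambda>k. B_edge P w k (Suc k)) [0..<n]"
      by (simp add: act_B)
    then show ?thesis using B_cell_path[OF that] by simp
  qed
  moreover have "act (B_obj P) l n (compose {..l} \<beta> \<alpha>) w
      = act (B_obj P) l m \<alpha> (act (B_obj P) m n \<beta> w)"
    if "\<alpha> \<in> Ups l m" "\<beta> \<in> Ups m n" "w \<in> B_cells P n" for l m n \<alpha> \<beta> w
    using B_edge_act[OF P that(2,3)] Ups_le[OF that(1)]
    by (subst (1 2) act_B) (simp add: compose_def)
  ultimately have "symmetric_set (B_obj P)"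
    using B_act_cell[OF P] unfolding symmetric_set_def cells_B by simp
  moreover have "edgy (B_obj P)"
    unfolding edgy_def cells_B by (auto simp: segal_B inj_on_def inj_map_eq_map inj_def)
  moreover have "reduced (B_obj P)"
    unfolding reduced_def cells_B by (auto simp: B_cells_def)
  ultimately show ?thesis by (simp add: partial_group_def)
qed

lemma B_map_edges:
  assumes P: "binary_partial_group P" and Q: "binary_partial_group Q"
    and f: "f \<in> bpg_hom P Q" and w: "w \<in> B_cells P n"
  shows "map f w \<in> B_cells Q n"
    and "i \<le> n \<Longrightarrow> j \<le> n \<Longrightarrow> B_edge Q (map f w) i j = f (B_edge P w i j)"
proof -
  note e = cocycle_image[OF cell_cocycle[OF P w] f]
  have "map f w = map (\<lambda>k. f (B_edge P w k (Suc k))) [0..<n]"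
    using arg_cong[OF B_cell_path[OF w], of "map f"] by (simp add: comp_def)
  then show "map f w \<in> B_cells Q n"
    "i \<le> n \<Longrightarrow> j \<le> n \<Longrightarrow> B_edge Q (map f w) i j = f (B_edge P w i j)"
    using cocycle_cell[OF e] cocycle_B_edge[OF Q e] by simp_all
qed

lemma B_map_hom:
  assumes P: "binary_partial_group P" and Q: "binary_partial_group Q" and f: "f \<in> bpg_hom P Q"
  shows "B_map P f \<in> sset_hom (B_obj P) (B_obj Q)"
proof -
  have "B_map P f m (act (B_obj P) m n \<alpha> w) = act (B_obj Q) m n \<alpha> (B_map P f n w)"
    if "\<alpha> \<in> Ups m n" "w \<in> B_cells P n" for m n \<alpha> w
  proof -
    have "map f (act (B_obj P) m n \<alpha> w) = act (B_obj Q) m n \<alpha> (map f w)"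
      using B_map_edges(2)[OF P Q f that(2)] Ups_le[OF that(1)] by (simp add: act_B)
    then show ?thesis using B_act_cell[OF P that] that by (simp add: B_map_def)
  qed
  moreover have "B_map P f n \<in> B_cells P n \<rightarrow>\<^sub>E B_cells Q n" for n
    using B_map_edges(1)[OF P Q f] by (simp add: B_map_def restrict_PiE_iff)
  ultimately show ?thesis by (simp add: sset_hom_def cells_B)
qed

lemma B_map_id: "B_map P (bpg_id P) = sset_id (B_obj P)"
proof -
  have "map (bpg_id P) w = w" if "w \<in> B_cells P n" for n w
    using that by (intro map_idI) (auto simp: B_cells_def bpg_id_def)
  then show ?thesis
    unfolding B_map_def sset_id_def cells_B by (intro ext) (simp add: restrict_def)
qed

lemma B_map_comp:
  assumes "binary_partial_group P" "binary_partial_group Q" "f \<in> bpg_hom P Q"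
  shows "B_map P (bpg_comp P g f) = sset_comp (B_obj P) (B_map Q g) (B_map P f)"
proof (intro ext)
  fix n w
  show "B_map P (bpg_comp P g f) n w = sset_comp (B_obj P) (B_map Q g) (B_map P f) n w"
  proof (cases "w \<in> B_cells P n")
    case True
    then have sub: "set w \<subseteq> elems P" by (simp add: B_cells_def)
    then have "map (bpg_comp P g f) w = map g (map f w)"
      by (auto simp: bpg_comp_def compose_def)
    then show ?thesis using True B_map_edges(1)[OF assms True]
      by (simp add: B_map_def sset_comp_def compose_def cells_B)
  next
    case False
    then show ?thesis by (simp add: B_map_def sset_comp_def compose_def cells_B)
  qed
qed

section \<open>The binary partial group TX\<close>

lemma symmetric_set_act_closed:
  "symmetric_set X \<Longrightarrow> \<alpha> \<in> Ups m n \<Longrightarrow> x \<in> cells X n \<Longrightarrow> act X m n \<alpha> x \<in> cells X m"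
  unfolding symmetric_set_def by blast

lemma act_edge_act:
  assumes X: "symmetric_set X" and a: "\<alpha> \<in> Ups m n" and x: "x \<in> cells X n"
    and ij: "i \<le> m" "j \<le> m"
  shows "act X 1 m (edge i j) (act X m n \<alpha> x) = act X 1 n (edge (\<alpha> i) (\<alpha> j)) x"
proof -
  have "compose {..1} \<alpha> (edge i j) = edge (\<alpha> i) (\<alpha> j)"
    by (auto simp: compose_def edge_def fun_eq_iff)
  then show ?thesis
    using X a x edge_Ups[OF ij] unfolding symmetric_set_def by metis
qed

lemma act_edge_id:
  assumes "symmetric_set X" "x \<in> cells X 1"
  shows "act X 1 1 (edge 0 1) x = x"
proof -
  have "edge 0 1 = (\<lambda>i\<in>{..1}. i)" by (auto simp: edge_def fun_eq_iff le_Suc_eq)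
  then show ?thesis using assms unfolding symmetric_set_def by simp
qed

lemma segal_2: "segal X 2 z = [act X 1 2 (edge 0 1) z, act X 1 2 (edge 1 2) z]"
  by (simp add: segal_def numeral_2_eq_2)

lemma elems_T: "elems (T_obj X) = cells X 1"
  by (simp add: T_obj_def)

lemma pmult_T_iff:
  assumes X: "partial_group X"
  shows "pmult (T_obj X) a b = Some c \<longleftrightarrow>
    (\<exists>z\<in>cells X 2. act X 1 2 (edge 0 1) z = a \<and> act X 1 2 (edge 1 2) z = b \<and>
       act X 1 2 (edge 0 2) z = c)"
proof -
  have inj: "inj_on (segal X 2) (cells X 2)"
    using X by (auto simp: partial_group_def edgy_def)
  have the: "(THE z'. z' \<in> cells X 2 \<and> segal X 2 z' = [a, b]) = z"
    if "z \<in> cells X 2" "segal X 2 z = [a, b]" for z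
    using that inj by (intro the_equality) (auto simp: inj_on_def)
  have "pmult (T_obj X) a b = Some c \<longleftrightarrow>
    (\<exists>z\<in>cells X 2. segal X 2 z = [a, b] \<and> act X 1 2 (edge 0 2) z = c)"
  proof (cases "\<exists>z\<in>cells X 2. segal X 2 z = [a, b]")
    case True
    then obtain z where z: "z \<in> cells X 2" "segal X 2 z = [a, b]" by blast
    have "pmult (T_obj X) a b = Some (act X 1 2 (edge 0 2) z)"
      using True the[OF z] by (simp add: T_obj_def)
    moreover have "z' = z" if "z' \<in> cells X 2" "segal X 2 z' = [a, b]" for z'
      by (rule inj_onD[OF inj]) (use that z in simp_all)
    ultimately show ?thesis using z by (metis option.inject)
  next
    case False
    then show ?thesis by (auto simp: T_obj_def)
  qed
  then show ?thesis by (simp add: segal_2)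
qed

text \<open>
  The vertices \<open>i\<close>, \<open>j\<close>, \<open>k\<close> of a simplex, in any order and with repetitions, span a \<open>2\<close>-simplex,
  which witnesses the product of the edges \<open>i \<rightarrow> j\<close> and \<open>j \<rightarrow> k\<close>.
\<close>

lemma T_cocycle:
  assumes X: "partial_group X" and x: "x \<in> cells X n"
  shows "cocycle (T_obj X) n (\<lambda>i j. act X 1 n (edge i j) x)"
proof -
  have S: "symmetric_set X" using X by (simp add: partial_group_def)
  have "pmult (T_obj X) (act X 1 n (edge i j) x) (act X 1 n (edge j k) x)
      = Some (act X 1 n (edge i k) x)" if "i \<le> n" "j \<le> n" "k \<le> n" for i j k
  proof -
    let ?\<alpha> = "\<lambda>l\<in>{..2::nat}. if l = 0 then i else if l = 1 then j else k"
    have a: "?\<alpha> \<in> Ups 2 n" using that by (auto simp: Ups_def)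
    show ?thesis
      unfolding pmult_T_iff[OF X]
      using symmetric_set_act_closed[OF S a x]
      by (intro bexI[of _ "act X 2 n ?\<alpha> x"]) (simp_all add: act_edge_act[OF S a x] del: One_nat_def)
  qed
  then show ?thesis
    using symmetric_set_act_closed[OF S edge_Ups x] by (simp add: cocycle_def elems_T)
qed

text \<open>A constant edge factors through a vertex, and a reduced symmetric set has only one.\<close>

lemma T_degenerate_edge:
  assumes X: "partial_group X" and x: "x \<in> cells X n" and i: "i \<le> n"
  shows "act X 1 n (edge i i) x = pone (T_obj X)"
proof -
  have S: "symmetric_set X" using X by (simp add: partial_group_def)
  have a: "(\<lambda>l\<in>{..0::nat}. i) \<in> Ups 0 n" using i by (auto simp: Ups_def)
  let ?p = "act X 0 n (\<lambda>l\<in>{..0::nat}. i) x"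
  obtain p where p: "cells X 0 = {p}"
    using X by (auto simp: partial_group_def reduced_def)
  then have "?p = p" using symmetric_set_act_closed[OF S a x] by simp
  moreover have "(THE x. x \<in> cells X 0) = p" using p by simp
  ultimately show ?thesis
    using act_edge_act[OF S a x, of 0 0] by (simp add: T_obj_def)
qed

text \<open>
  The inverse of a \<open>1\<close>-simplex is its reversal; the inverse laws are then the cocycle condition for
  reordered vertices of the \<open>2\<close>-simplex that witnesses a product.
\<close>

lemma binary_partial_group_T:
  assumes X: "partial_group X"
  shows "binary_partial_group (T_obj X)"
proof -
  have S: "symmetric_set X" using X by (simp add: partial_group_def)
  have closed: "c \<in> cells X 1" if "pmult (T_obj X) a b = Some c" for a b c
    using that symmetric_set_act_closed[OF S edge_Ups[of 0 2 2]] by (auto simp: pmult_T_iff[OF X])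
  have one: "pmult (T_obj X) a (pone (T_obj X)) = Some a"
      "pmult (T_obj X) (pone (T_obj X)) a = Some a"
    if a: "a \<in> cells X 1" for a
    using cocycle_mult[OF T_cocycle[OF X a], of 0 1 1] cocycle_mult[OF T_cocycle[OF X a], of 0 0 1]
      act_edge_id[OF S a] T_degenerate_edge[OF X a, of 0] T_degenerate_edge[OF X a, of 1]
    by simp_all
  obtain p where "p \<in> cells X 0" using X by (auto simp: partial_group_def reduced_def)
  then have "pone (T_obj X) \<in> cells X 1"
    using T_degenerate_edge[OF X, of p 0 0] symmetric_set_act_closed[OF S edge_Ups[of 0 0 0], of p]
    by simp
  with closed one have "unital_partial_magma (T_obj X)"
    unfolding unital_partial_magma_def elems_T by blast
  moreover have "is_pinv (T_obj X) a (act X 1 1 (edge 1 0) a)" if a: "a \<in> cells X 1" for a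
  proof -
    have flip: "act X 1 1 (edge 1 0) (act X 1 2 (edge i j) z) = act X 1 2 (edge j i) z"
      if "z \<in> cells X 2" "i \<le> 2" "j \<le> 2" for z i j
      using act_edge_act[OF S edge_Ups[OF that(2,3)] that(1), of 1 0] by (simp add: edge_def)
    have "pmult (T_obj X) (act X 1 1 (edge 1 0) a) c = Some b"
      if "pmult (T_obj X) a b = Some c" for b c
    proof -
      obtain z where "z \<in> cells X 2" "act X 1 2 (edge 0 1) z = a" "act X 1 2 (edge 1 2) z = b"
        "act X 1 2 (edge 0 2) z = c" using \<open>pmult (T_obj X) a b = Some c\<close> pmult_T_iff[OF X] by blast
      then show ?thesis
        using cocycle_mult[OF T_cocycle[OF X, of z 2], of 1 0 2] flip[of z 0 1] by simp
    qed
    moreover have "pmult (T_obj X) c (act X 1 1 (edge 1 0) a) = Some b"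
      if "pmult (T_obj X) b a = Some c" for b c
    proof -
      obtain z where "z \<in> cells X 2" "act X 1 2 (edge 0 1) z = b" "act X 1 2 (edge 1 2) z = a"
        "act X 1 2 (edge 0 2) z = c" using \<open>pmult (T_obj X) b a = Some c\<close> pmult_T_iff[OF X] by blast
      then show ?thesis
        using cocycle_mult[OF T_cocycle[OF X, of z 2], of 0 2 1] flip[of z 1 2] by simp
    qed
    ultimately show ?thesis
      using symmetric_set_act_closed[OF S edge_Ups[of 1 1 0] a] by (simp add: is_pinv_def elems_T)
  qed
  ultimately show ?thesis by (auto simp: binary_partial_group_def elems_T)
qed

lemma sset_hom_closed: "f \<in> sset_hom X Y \<Longrightarrow> x \<in> cells X n \<Longrightarrow> f n x \<in> cells Y n"
  by (auto simp: sset_hom_def)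

lemma sset_hom_act:
  "f \<in> sset_hom X Y \<Longrightarrow> \<alpha> \<in> Ups m n \<Longrightarrow> x \<in> cells X n \<Longrightarrow> f m (act X m n \<alpha> x) = act Y m n \<alpha> (f n x)"
  by (simp add: sset_hom_def)

lemma T_map_hom:
  assumes X: "partial_group X" and Y: "partial_group Y" and f: "f \<in> sset_hom X Y"
  shows "T_map f \<in> bpg_hom (T_obj X) (T_obj Y)"
proof -
  have "pmult (T_obj Y) (f 1 a) (f 1 b) = Some (f 1 c)" if ab: "pmult (T_obj X) a b = Some c" for a b c
  proof -
    obtain z where z: "z \<in> cells X 2" "act X 1 2 (edge 0 1) z = a" "act X 1 2 (edge 1 2) z = b"
      "act X 1 2 (edge 0 2) z = c" using ab pmult_T_iff[OF X] by blast
    have "f 1 (act X 1 2 (edge i j) z) = act Y 1 2 (edge i j) (f 2 z)" if "i \<le> 2" "j \<le> 2" for i j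
      using sset_hom_act[OF f edge_Ups[OF that] z(1)] .
    then have "f 1 a = act Y 1 2 (edge 0 1) (f 2 z)" "f 1 b = act Y 1 2 (edge 1 2) (f 2 z)"
      "f 1 c = act Y 1 2 (edge 0 2) (f 2 z)"
      unfolding z(2-4)[symmetric] by simp_all
    then show ?thesis
      unfolding pmult_T_iff[OF Y] using sset_hom_closed[OF f z(1)]
      by (intro bexI[of _ "f 2 z"]) simp_all
  qed
  then show ?thesis using f by (simp add: bpg_hom_def T_map_def elems_T sset_hom_def)
qed

section \<open>The Segal maps and the adjunction\<close>

lemma eta_path: "x \<in> cells X n \<Longrightarrow> eta X n x = map (\<lambda>k. act X 1 n (edge k (Suc k)) x) [0..<n]"
  by (simp add: eta_def segal_def)

lemma eta_cell:
  assumes "partial_group X" "x \<in> cells X n"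
  shows "eta X n x \<in> B_cells (T_obj X) n"
  using cocycle_cell[OF T_cocycle[OF assms]] eta_path[OF assms(2)] by simp

lemma eta_hom:
  assumes X: "partial_group X"
  shows "eta X \<in> sset_hom X (B_obj (T_obj X))"
proof -
  have S: "symmetric_set X" using X by (simp add: partial_group_def)
  have "eta X m (act X m n \<alpha> x) = act (B_obj (T_obj X)) m n \<alpha> (eta X n x)"
    if a: "\<alpha> \<in> Ups m n" and x: "x \<in> cells X n" for m n \<alpha> x
    using cocycle_B_edge[OF binary_partial_group_T[OF X] T_cocycle[OF X x]]
      Ups_le[OF a] symmetric_set_act_closed[OF S a x]
    by (simp add: eta_path x act_B act_edge_act[OF S a x] del: One_nat_def)
  then show ?thesis
    using eta_cell[OF X] unfolding sset_hom_def cells_B by (auto simp: eta_def)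
qed

lemma B_map_eta:
  assumes "partial_group X" "x \<in> cells X n"
  shows "sset_comp X (B_map (T_obj X) g) (eta X) n x
    = map (\<lambda>k. g (act X 1 n (edge k (Suc k)) x)) [0..<n]"
  using eta_cell[OF assms] eta_path[OF assms(2)] assms(2)
  by (simp add: sset_comp_def B_map_def compose_def)

lemma eta_natural:
  assumes X: "partial_group X" and f: "f \<in> sset_hom X Y"
  shows "sset_comp X (eta Y) f = sset_comp X (B_map (T_obj X) (T_map f)) (eta X)"
proof (intro ext)
  fix n x
  show "sset_comp X (eta Y) f n x = sset_comp X (B_map (T_obj X) (T_map f)) (eta X) n x"
  proof (cases "x \<in> cells X n")
    case True
    then show ?thesis
      using sset_hom_act[OF f edge_Ups True] sset_hom_closed[OF f True]
      unfolding B_map_eta[OF X True]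
      by (simp add: T_map_def sset_comp_def compose_def eta_path del: One_nat_def)
  next
    case False
    then show ?thesis by (simp add: sset_comp_def compose_def)
  qed
qed

text \<open>
  The transpose of a map \<open>h\<close> into \<open>BP\<close>: each \<open>h 1 x\<close> is a word of length one, whose only letter is
  the value of the transpose at \<open>x\<close>.
\<close>

lemma transpose_hom:
  assumes X: "partial_group X" and P: "binary_partial_group P" and h: "h \<in> sset_hom X (B_obj P)"
  shows "(\<lambda>x\<in>cells X 1. hd (h 1 x)) \<in> bpg_hom (T_obj X) P"
proof -
  have S: "symmetric_set X" using X by (simp add: partial_group_def)
  have "hd (h 1 x) \<in> elems P" if "x \<in> cells X 1" for x
    using sset_hom_closed[OF h that] by (cases "h 1 x") (auto simp: cells_B B_cells_def)
  moreover have "pmult P (hd (h 1 a)) (hd (h 1 b)) = Some (hd (h 1 c))" and "c \<in> cells X 1"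
    if ab: "pmult (T_obj X) a b = Some c" for a b c
  proof -
    obtain z where z: "z \<in> cells X 2" "act X 1 2 (edge 0 1) z = a" "act X 1 2 (edge 1 2) z = b"
      "act X 1 2 (edge 0 2) z = c" using ab pmult_T_iff[OF X] by blast
    show "c \<in> cells X 1" using symmetric_set_act_closed[OF S edge_Ups z(1), of 0 2] z by simp
    have "hd (h 1 (act X 1 2 (edge i j) z)) = B_edge P (h 2 z) i j" if "i \<le> 2" "j \<le> 2" for i j
      using sset_hom_act[OF h edge_Ups[OF that] z(1)] B_act_edge[of P 2 i j] by simp
    moreover have "cocycle P 2 (B_edge P (h 2 z))"
      using sset_hom_closed[OF h z(1)] cell_cocycle[OF P] by (simp add: cells_B)
    ultimately show "pmult P (hd (h 1 a)) (hd (h 1 b)) = Some (hd (h 1 c))"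
      using cocycle_mult[of P 2 _ 0 1 2] z by fastforce
  qed
  ultimately show ?thesis by (auto simp: bpg_hom_def elems_T)
qed

lemma adjunction_bij:
  assumes X: "partial_group X" and P: "binary_partial_group P"
  shows "bij_betw (\<lambda>g. sset_comp X (B_map (T_obj X) g) (eta X))
    (bpg_hom (T_obj X) P) (sset_hom X (B_obj P))"
proof -
  have S: "symmetric_set X" using X by (simp add: partial_group_def)
  let ?F = "\<lambda>g. sset_comp X (B_map (T_obj X) g) (eta X)"
  let ?G = "\<lambda>h. \<lambda>x\<in>cells X 1. hd (h 1 x)"
  show ?thesis
  proof (rule bij_betwI[of _ _ _ ?G])
    show "?F \<in> bpg_hom (T_obj X) P \<rightarrow> sset_hom X (B_obj P)"
    proof
      fix g assume "g \<in> bpg_hom (T_obj X) P"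
      then have g: "B_map (T_obj X) g \<in> sset_hom (B_obj (T_obj X)) (B_obj P)"
        using B_map_hom[OF binary_partial_group_T[OF X] P] by blast
      show "?F g \<in> sset_hom X (B_obj P)"
        using sset_hom_closed[OF g sset_hom_closed[OF eta_hom[OF X]]]
          sset_hom_act[OF g _ sset_hom_closed[OF eta_hom[OF X]]] sset_hom_act[OF eta_hom[OF X]]
          symmetric_set_act_closed[OF S]
        unfolding sset_hom_def by (auto simp: sset_comp_def compose_def)
    qed
    show "?G \<in> sset_hom X (B_obj P) \<rightarrow> bpg_hom (T_obj X) P"
      using transpose_hom[OF X P] by blast
    show "?G (?F g) = g" if g: "g \<in> bpg_hom (T_obj X) P" for g
    proof (rule extensionalityI[of _ "cells X 1"])
      show "g \<in> extensional (cells X 1)" using g by (auto simp: bpg_hom_def elems_T PiE_def)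
      show "?G (?F g) x = g x" if "x \<in> cells X 1" for x
        using B_map_eta[OF X that, of g] act_edge_id[OF S that] that by simp
    qed simp
    show "?F (?G h) = h" if h: "h \<in> sset_hom X (B_obj P)" for h
    proof (intro ext)
      fix n x
      show "?F (?G h) n x = h n x"
      proof (cases "x \<in> cells X n")
        case True
        have cell: "h n x \<in> B_cells P n" using sset_hom_closed[OF h True] by (simp add: cells_B)
        have "?G h (act X 1 n (edge k (Suc k)) x) = B_edge P (h n x) k (Suc k)" if "k < n" for k
        proof -
          have e: "edge k (Suc k) \<in> Ups 1 n" using that by (intro edge_Ups) simp_all
          show ?thesis
            using sset_hom_act[OF h e True] symmetric_set_act_closed[OF S e True]
              B_act_edge[of P n k "Suc k" "h n x"] by (simp del: One_nat_def)
        qed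
        then have "?F (?G h) n x = map (\<lambda>k. B_edge P (h n x) k (Suc k)) [0..<n]"
          using B_map_eta[OF X True, of "?G h"] by simp
        then show ?thesis using B_cell_path[OF cell] by simp
      next
        case False
        moreover have "h n \<in> extensional (cells X n)" using h by (auto simp: sset_hom_def PiE_def)
        ultimately show ?thesis by (simp add: sset_comp_def compose_def extensional_def)
      qed
    qed
  qed
qed

theorem theorem10:
  fixes X :: "'a symset" and Y :: "'b symset" and Z :: "'c symset"
    and P :: "'p pmagma" and Q :: "'q pmagma" and R :: "'r pmagma"
  assumes "partial_group X" and "partial_group Y" and "partial_group Z"
    and "binary_partial_group P" and "binary_partial_group Q" and "binary_partial_group R"
  shows
    \<comment> \<open>T is a functor\<close>
    "(binary_partial_group (T_obj X) \<and>
      (\<forall>f\<in>sset_hom X Y. T_map f \<in> bpg_hom (T_obj X) (T_obj Y)) \<and>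
      T_map (sset_id X) = bpg_id (T_obj X) \<and>
      (\<forall>f\<in>sset_hom X Y. \<forall>g\<in>sset_hom Y Z.
         T_map (sset_comp X g f) = bpg_comp (T_obj X) (T_map g) (T_map f))) \<and>
    \<comment> \<open>B is a functor\<close>
     (partial_group (B_obj P) \<and>
      (\<forall>f\<in>bpg_hom P Q. B_map P f \<in> sset_hom (B_obj P) (B_obj Q)) \<and>
      B_map P (bpg_id P) = sset_id (B_obj P) \<and>
      (\<forall>f\<in>bpg_hom P Q. \<forall>g\<in>bpg_hom Q R.
         B_map P (bpg_comp P g f) = sset_comp (B_obj P) (B_map Q g) (B_map P f))) \<and>
    \<comment> \<open>the Segal maps form a natural transformation from the identity to BT\<close>
     (eta X \<in> sset_hom X (B_obj (T_obj X)) \<and>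
      (\<forall>f\<in>sset_hom X Y.
         sset_comp X (eta Y) f = sset_comp X (B_map (T_obj X) (T_map f)) (eta X))) \<and>
    \<comment> \<open>which is the unit of an adjunction between T and B\<close>
     bij_betw (\<lambda>g. sset_comp X (B_map (T_obj X) g) (eta X))
       (bpg_hom (T_obj X) P) (sset_hom X (B_obj P))"
proof (intro conjI ballI)
  show "binary_partial_group (T_obj X)" using binary_partial_group_T assms by blast
  show "T_map f \<in> bpg_hom (T_obj X) (T_obj Y)" if "f \<in> sset_hom X Y" for f
    using T_map_hom assms that by blast
  show "T_map (sset_id X) = bpg_id (T_obj X)"
    unfolding T_map_def sset_id_def bpg_id_def elems_T by (rule refl)
  show "T_map (sset_comp X g f) = bpg_comp (T_obj X) (T_map g) (T_map f)" for f g
    by (simp add: T_map_def sset_comp_def bpg_comp_def elems_T)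
  show "partial_group (B_obj P)" using partial_group_B assms by blast
  show "B_map P f \<in> sset_hom (B_obj P) (B_obj Q)" if "f \<in> bpg_hom P Q" for f
    using B_map_hom assms that by blast
  show "B_map P (bpg_id P) = sset_id (B_obj P)" by (rule B_map_id)
  show "B_map P (bpg_comp P g f) = sset_comp (B_obj P) (B_map Q g) (B_map P f)"
    if "f \<in> bpg_hom P Q" for f g
    using B_map_comp assms that by blast
  show "eta X \<in> sset_hom X (B_obj (T_obj X))" using eta_hom assms by blast
  show "sset_comp X (eta Y) f = sset_comp X (B_map (T_obj X) (T_map f)) (eta X)"
    if "f \<in> sset_hom X Y" for f
    using eta_natural assms that by blast
  show "bij_betw (\<lambda>g. sset_comp X (B_map (T_obj X) g) (eta X))
      (bpg_hom (T_obj X) P) (sset_hom X (B_obj P))"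
    using adjunction_bij assms by blast
qed

end
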